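(* Let $p,h$ be real numbers with $0<h<\min\{p,\tfrac12\}$, and consider the difference equation $$x_{n+1}=F(x_n,x_{n-1})=\frac{p+2p\,x_n}{1+x_n+x_{n-1}}-h,\qquad n=0,1,\ldots.$$ Then its positive equilibrium $x^*=p-h$ is globally asymptotically stable with respect to the invariant set $\Omega$, where $\Omega$ is the compact region bounded by the polygon with consecutive vertices $(c,c)$, $(x^*,c)$, $(0,x^* )$, $(0,0)$, $(c,0)$ and $c=\frac{x^*}{h}(x^*+p+1)$.
   Context: An equilibrium is a number $x^*$ with $F(x^*,x^* )=x^*$. Globally asymptotically stable with respect to $\Omega$ means that $x^*$ is locally (Lyapunov) stable and that every solution with $(x_0,x_{-1})\in\Omega$ converges to $x^*$. The set $\Omega$ is invariant in the sense that $(x,y)\in\Omega$ implies $(F(x,y),x)\in\Omega$. *)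

theory Defs
  imports "HOL-Analysis.Analysis"
begin

definition equilibrium :: "(real \<Rightarrow> real \<Rightarrow> real) \<Rightarrow> real \<Rightarrow> bool" where
  "equilibrium F xs \<longleftrightarrow> F xs xs = xs"

text \<open>Solutions of \<open>x\<^sub>n\<^sub>+\<^sub>1 = F(x\<^sub>n, x\<^sub>n\<^sub>-\<^sub>1)\<close> start at index \<open>-1\<close>; they are represented as sequences over
  \<^typ>\<open>nat\<close> shifted by one, so \<open>x 0\<close> stands for \<open>x\<^sub>-\<^sub>1\<close> and \<open>x 1\<close> for \<open>x\<^sub>0\<close>.\<close>

definition is_solution :: "(real \<Rightarrow> real \<Rightarrow> real) \<Rightarrow> (nat \<Rightarrow> real) \<Rightarrow> bool" where
  "is_solution F x \<longleftrightarrow> (\<forall>n. x (n + 2) = F (x (n + 1)) (x n))"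

text \<open>Lyapunov stability, with the initial data \<open>(x\<^sub>0, x\<^sub>-\<^sub>1)\<close> ranging over a full neighbourhood in the plane.\<close>

definition locally_stable :: "(real \<Rightarrow> real \<Rightarrow> real) \<Rightarrow> real \<Rightarrow> bool" where
  "locally_stable F xs \<longleftrightarrow>
     (\<forall>\<epsilon>>0. \<exists>\<delta>>0. \<forall>x. is_solution F x \<and> \<bar>x 1 - xs\<bar> + \<bar>x 0 - xs\<bar> < \<delta>
        \<longrightarrow> (\<forall>n. \<bar>x n - xs\<bar> < \<epsilon>))"

definition globally_asymptotically_stable ::
  "(real \<Rightarrow> real \<Rightarrow> real) \<Rightarrow> real \<Rightarrow> (real \<times> real) set \<Rightarrow> bool" where
  "globally_asymptotically_stable F xs \<Omega> \<longleftrightarrow>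
     locally_stable F xs \<and>
     (\<forall>x. is_solution F x \<and> (x 1, x 0) \<in> \<Omega> \<longrightarrow> x \<longlonglongrightarrow> xs)"

definition invariant_set :: "(real \<Rightarrow> real \<Rightarrow> real) \<Rightarrow> (real \<times> real) set \<Rightarrow> bool" where
  "invariant_set F \<Omega> \<longleftrightarrow> (\<forall>x y. (x, y) \<in> \<Omega> \<longrightarrow> (F x y, x) \<in> \<Omega>)"

text \<open>The closed polygonal curve through the listed vertices (the last one is joined to the first).\<close>

definition polygon :: "(real \<times> real) list \<Rightarrow> (real \<times> real) set" where
  "polygon vs = (\<Union>i<length vs. closed_segment (vs ! i) (vs ! (Suc i mod length vs)))"

definition polygon_region :: "(real \<times> real) list \<Rightarrow> (real \<times> real) set" where
  "polygon_region vs = polygon vs \<union> inside (polygon vs)"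

end

theory Submission imports Defs begin

text \<open>With \<open>a = p - h\<close> the map reads \<open>F x y - a = p (x - y) / (1 + x + y)\<close>, and \<open>2 p < 1 + 2 a\<close>. Hence
  \<open>F\<close> contracts the maximum norm near \<open>(a, a)\<close>, which gives stability, and \<open>F\<close> increases in \<open>x\<close> and
  decreases in \<open>y\<close> on the first quadrant. For attractivity let \<open>S \<ge> a\<close> and \<open>I \<le> a\<close> be the upper and
  lower limits of a solution (truncated at \<open>a\<close>). Monotonicity gives \<open>S \<le> F S I\<close>, and looking back
  three steps gives \<open>min (F a S) (F I a) \<le> I\<close>; these two inequalities force \<open>S = I = a\<close>.\<close>

locale delay_map =
  fixes p h xs c :: real and F :: "real \<Rightarrow> real \<Rightarrow> real"
  assumes h_pos: "0 < h" and h_less: "h < min p (1 / 2)"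
    and F_eq: "\<And>x y. F x y = (p + 2 * p * x) / (1 + x + y) - h"
    and xs_eq: "xs = p - h"
    and c_eq: "c = xs / h * (xs + p + 1)"
begin

section \<open>Elementary properties of the map and its equilibrium\<close>

lemma p_pos: "0 < p" and xs_pos: "0 < xs" and p_less: "2 * p < 1 + 2 * xs"
  using h_pos h_less xs_eq by auto

text \<open>The choice of \<open>c\<close> cleared of division. It expresses that
  \<open>F xs c = 0\<close>, and equally that the line through \<open>(0, xs)\<close> and
  \<open>(xs, c)\<close> has slope \<open>(2 * xs + 1) / h\<close>.\<close>

lemma hc_eq: "h * c = xs * (2 * xs + h + 1)"
proof -
  have "h * c = xs * (xs + p + 1)" using h_pos unfolding c_eq by simp
  then show ?thesis using xs_eq by simp
qed

lemma xs_less_c: "xs < c"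
proof -
  have "h * xs < h * c"
    unfolding hc_eq using xs_pos by (simp add: algebra_simps add_pos_pos)
  then show ?thesis using h_pos by simp
qed

lemma F_deviation:
  assumes "1 + x + y \<noteq> 0"
  shows "F x y = xs + p * ((x - y) / (1 + x + y))"
  using assms by (simp add: F_eq xs_eq field_simps)

lemma F_mono:
  assumes "0 \<le> x" "x \<le> x'" "0 \<le> y'" "y' \<le> y"
  shows "F x y \<le> F x' y'"
proof -
  \<comment> \<open>After cross-multiplying, \<open>x * x'\<close> and \<open>y * y'\<close> cancel;
    this compares the products that remain.\<close>
  have "y' * x \<le> y * x'" using assms by (intro mult_mono) auto
  then have "(x - y) * (1 + x' + y') \<le> (x' - y') * (1 + x + y)"
    using assms by (simp add: algebra_simps)
  then have "(x - y) / (1 + x + y) \<le> (x' - y') / (1 + x' + y')"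
    using assms by (simp add: divide_simps)
  then have "p * ((x - y) / (1 + x + y)) \<le> p * ((x' - y') / (1 + x' + y'))"
    using p_pos by (intro mult_left_mono) auto
  then show ?thesis using assms by (simp add: F_deviation)
qed

text \<open>On the diagonal the quotient in \<open>F_deviation\<close> vanishes, so
  \<open>F x x = xs\<close> for every positive \<open>x\<close>.\<close>

lemma positive_equilibrium: "{x. 0 < x \<and> equilibrium F x} = {xs}"
  using xs_pos by (auto simp: equilibrium_def F_deviation)

section \<open>Local stability\<close>

lemma locally_stable_xs: "locally_stable F xs"
  unfolding locally_stable_def
proof (intro allI impI)
  fix \<epsilon> :: real assume "0 < \<epsilon>"
  \<comment> \<open>The second bound ensures \<open>2 * p < 1 + x + y\<close> whenever
    \<open>x\<close> and \<open>y\<close> are within \<open>e\<close> of \<open>xs\<close>. They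
    then differ by less than \<open>2 * e\<close>, so \<open>F x y\<close> is again within
    \<open>e\<close>, and \<open>e\<close> itself serves as \<open>\<delta>\<close>.\<close>
  define e where "e = min \<epsilon> ((1 + 2 * xs - 2 * p) / 2)"
  have e: "0 < e" "e \<le> \<epsilon>" "2 * e \<le> 1 + 2 * xs - 2 * p"
    using \<open>0 < \<epsilon>\<close> p_less by (auto simp: e_def min_def)
  have contract: "\<bar>F x y - xs\<bar> < e" if "\<bar>x - xs\<bar> < e" "\<bar>y - xs\<bar> < e" for x y
  proof -
    have d: "2 * p < 1 + x + y" using that e by linarith
    have "p * \<bar>x - y\<bar> < p * (2 * e)"
      using that p_pos by (intro mult_strict_left_mono) linarith+
    also have "\<dots> < e * (1 + x + y)"
      using mult_strict_left_mono[OF d, of e] e by (simp add: mult_ac)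
    finally have "p * \<bar>x - y\<bar> / (1 + x + y) < e"
      using d p_pos by (simp add: divide_simps)
    then show ?thesis
      using d p_pos by (simp add: F_deviation abs_mult)
  qed
  have "\<forall>n. \<bar>x n - xs\<bar> < \<epsilon>"
    if sol: "is_solution F x" and start: "\<bar>x 1 - xs\<bar> + \<bar>x 0 - xs\<bar> < e" for x
  proof -
    have "\<bar>x n - xs\<bar> < e \<and> \<bar>x (Suc n) - xs\<bar> < e" for n
    proof (induction n)
      case 0
      then show ?case using start by auto
    next
      case (Suc n)
      then show ?case
        using sol contract[of "x (Suc n)" "x n"] by (simp add: is_solution_def)
    qed
    then show ?thesis using e by (meson less_le_trans)
  qed
  then show "\<exists>\<delta>>0. \<forall>x. is_solution F x \<and> \<bar>x 1 - xs\<bar> + \<bar>x 0 - xs\<bar> < \<delta>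
      \<longrightarrow> (\<forall>n. \<bar>x n - xs\<bar> < \<epsilon>)"
    using e by blast
qed

section \<open>Geometry of the region\<close>

text \<open>The convex hull of the five vertices given by inequalities: the last one cuts the upper
  left corner off the square along the line through \<open>(0, xs)\<close> and
  \<open>(xs, c)\<close>.\<close>

definition pentagon :: "(real \<times> real) set" where
  "pentagon = {(x, y). 0 \<le> x \<and> x \<le> c \<and> 0 \<le> y \<and> y \<le> c \<and> h * (y - xs) \<le> (2 * xs + 1) * x}"

text \<open>Puts the pentagon in the form to which the half-space facts on interior, convexity and
  closedness apply.\<close>

lemma pentagon_halfspaces:
  "pentagon = {z. (-1, 0) \<bullet> z \<le> 0} \<inter> {z. (1, 0) \<bullet> z \<le> c} \<inter> {z. (0, -1) \<bullet> z \<le> 0} \<inter>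
     {z. (0, 1) \<bullet> z \<le> c} \<inter> {z. (- (2 * xs + 1), h) \<bullet> z \<le> h * xs}"
  by (auto simp: pentagon_def algebra_simps)

lemma interior_pentagon:
  "interior pentagon =
     {(x, y). 0 < x \<and> x < c \<and> 0 < y \<and> y < c \<and> h * (y - xs) < (2 * xs + 1) * x}"
proof -
  have "(-1, 0) \<noteq> (0 :: real \<times> real)" "(1, 0) \<noteq> (0 :: real \<times> real)"
    "(0, -1) \<noteq> (0 :: real \<times> real)" "(0, 1) \<noteq> (0 :: real \<times> real)"
    "(- (2 * xs + 1), h) \<noteq> (0 :: real \<times> real)"
    using h_pos by (simp_all add: zero_prod_def)
  note halfspaces = this[THEN interior_halfspace_le]
  show ?thesis
    unfolding pentagon_halfspaces interior_Int halfspaces by (auto simp: algebra_simps)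
qed

lemma convex_pentagon: "convex pentagon"
  unfolding pentagon_halfspaces by (intro convex_Int convex_halfspace_le)

lemma compact_pentagon: "compact pentagon"
proof -
  have "closed pentagon"
    unfolding pentagon_halfspaces by (intro closed_Int closed_halfspace_le)
  moreover have "pentagon \<subseteq> cbox (0, 0) (c, c)"
    by (auto simp: pentagon_def cbox_Pair_eq)
  ultimately show ?thesis
    by (meson bounded_cbox bounded_subset compact_eq_bounded_closed)
qed

text \<open>Each edge stays in the pentagon by convexity, and one of the five inequalities is tight
  along it. Conversely, a point outside the interior makes some inequality tight, and the others
  confine it to the matching edge.\<close>

lemma polygon_eq_frontier:
  "polygon [(c, c), (xs, c), (0, xs), (0, 0), (c, 0)] = frontier pentagon"
proof -
  have slope: "h * (c - xs) = xs * (2 * xs + 1)"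
    using hc_eq by (simp add: algebra_simps)
  have five: "{..<Suc (Suc (Suc (Suc (Suc 0))))} = {0, 1, 2, 3, 4}" by auto
  have "polygon [(c, c), (xs, c), (0, xs), (0, 0), (c, 0)] =
      closed_segment (c, c) (xs, c) \<union> closed_segment (xs, c) (0, xs) \<union>
      closed_segment (0, xs) (0, 0) \<union> closed_segment (0, 0) (c, 0) \<union> closed_segment (c, 0) (c, c)"
    using five by (simp add: polygon_def Un_assoc)
  also have "\<dots> = pentagon - interior pentagon"
  proof (intro subset_antisym Un_least)
    have verts: "(c, c) \<in> pentagon" "(xs, c) \<in> pentagon" "(0, xs) \<in> pentagon"
        "(0, 0) \<in> pentagon" "(c, 0) \<in> pentagon"
      using xs_pos xs_less_c h_pos slope mult_left_mono[of xs c "2 * xs + 1"]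
      by (auto simp: pentagon_def algebra_simps)
    note sub = closed_segment_subset[OF _ _ convex_pentagon]
    show "closed_segment (c, c) (xs, c) \<subseteq> pentagon - interior pentagon"
      using sub[OF verts(1,2)] unfolding interior_pentagon
      by (auto simp: closed_segment_def algebra_simps)
    show "closed_segment (0, xs) (0, 0) \<subseteq> pentagon - interior pentagon"
      using sub[OF verts(3,4)] unfolding interior_pentagon
      by (auto simp: closed_segment_def algebra_simps)
    show "closed_segment (0, 0) (c, 0) \<subseteq> pentagon - interior pentagon"
      using sub[OF verts(4,5)] unfolding interior_pentagon
      by (auto simp: closed_segment_def algebra_simps)
    show "closed_segment (c, 0) (c, c) \<subseteq> pentagon - interior pentagon"
      using sub[OF verts(5,1)] unfolding interior_pentagon
      by (auto simp: closed_segment_def algebra_simps)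
    \<comment> \<open>The slanted inequality is tight at the point with parameter \<open>u\<close>
      on the edge from \<open>(xs, c)\<close> to \<open>(0, xs)\<close>.\<close>
    have "h * (((1 - u) * c + u * xs) - xs) = (2 * xs + 1) * ((1 - u) * xs)" for u
    proof -
      have "h * (((1 - u) * c + u * xs) - xs) = (1 - u) * (h * (c - xs))"
        by (simp add: algebra_simps)
      then show ?thesis unfolding slope by simp
    qed
    then show "closed_segment (xs, c) (0, xs) \<subseteq> pentagon - interior pentagon"
      using sub[OF verts(2,3)] unfolding interior_pentagon
      by (auto simp: closed_segment_def)
  next
    show "pentagon - interior pentagon \<subseteq> closed_segment (c, c) (xs, c) \<union>
        closed_segment (xs, c) (0, xs) \<union> closed_segment (0, xs) (0, 0) \<union>
        closed_segment (0, 0) (c, 0) \<union> closed_segment (c, 0) (c, c)"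
    proof
      fix z assume z: "z \<in> pentagon - interior pentagon"
      obtain x y where xy: "z = (x, y)" by fastforce
      have b: "0 \<le> x" "x \<le> c" "0 \<le> y" "y \<le> c" "h * (y - xs) \<le> (2 * xs + 1) * x"
        using z by (auto simp: xy pentagon_def)
      from z consider "x = 0" | "x = c" | "y = 0" | "y = c" | "h * (y - xs) = (2 * xs + 1) * x"
        using b by (simp add: xy interior_pentagon) linarith
      then show "z \<in> closed_segment (c, c) (xs, c) \<union>
        closed_segment (xs, c) (0, xs) \<union> closed_segment (0, xs) (0, 0) \<union>
        closed_segment (0, 0) (c, 0) \<union> closed_segment (c, 0) (c, c)"
      proof cases
        case 1
        then have "y \<le> xs" using b h_pos by (simp add: mult_le_0_iff)
        then show ?thesis
          using 1 b by (simp add: xy closed_segment_same_fst closed_segment_eq_real_ivl)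
      next
        case 2
        then show ?thesis
          using b by (simp add: xy closed_segment_same_fst closed_segment_eq_real_ivl)
      next
        case 3
        then show ?thesis
          using b by (simp add: xy closed_segment_same_snd closed_segment_eq_real_ivl)
      next
        case 4
        then have "(2 * xs + 1) * xs \<le> (2 * xs + 1) * x" using b slope by (simp add: mult.commute)
        then have "xs \<le> x" using xs_pos by simp
        then show ?thesis
          using 4 b by (simp add: xy closed_segment_same_snd closed_segment_eq_real_ivl)
      next
        case 5
        \<comment> \<open>The segment parameter read off from the first coordinate; tightness then
          determines \<open>y\<close>, and \<open>y \<le> c\<close> gives
          \<open>0 \<le> u\<close>.\<close>
        define u where "u = 1 - x / xs"
        have x: "x = (1 - u) * xs" using xs_pos by (simp add: u_def)
        have "h * (y - xs) = (1 - u) * (h * (c - xs))" unfolding 5 slope x by simp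
        then have "h * (y - xs) = h * ((1 - u) * (c - xs))" by simp
        then have "y - xs = (1 - u) * (c - xs)" using h_pos by (simp del: mult_cancel_left add: mult_left_cancel)
        then have y: "y = (1 - u) * c + u * xs" by (simp add: algebra_simps)
        have "(1 - u) * (c - xs) \<le> 1 * (c - xs)" using b y by (simp add: algebra_simps)
        then have "0 \<le> u" using xs_less_c by (simp add: mult_le_cancel_right)
        moreover have "u \<le> 1" using b xs_pos by (simp add: u_def)
        ultimately have "z \<in> closed_segment (xs, c) (0, xs)"
          unfolding closed_segment_def xy using x y by auto
        then show ?thesis by blast
      qed
    qed
  qed
  also have "\<dots> = frontier pentagon"
    using compact_pentagon by (simp add: frontier_def compact_imp_closed)
  finally show ?thesis .
qed

text \<open>For a bounded convex set, the inside of the frontier is the interior; the pentagon is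
  closed, so the two together give it back.\<close>

lemma polygon_region_eq_pentagon:
  "polygon_region [(c, c), (xs, c), (0, xs), (0, 0), (c, 0)] = pentagon"
proof -
  have "closure pentagon = pentagon"
    using compact_pentagon by (simp add: compact_imp_closed)
  moreover have "inside (frontier pentagon) = interior pentagon"
    by (intro inside_frontier_eq_interior compact_imp_bounded compact_pentagon convex_pentagon)
  ultimately show ?thesis
    unfolding polygon_region_def polygon_eq_frontier
    using interior_subset[of pentagon] by (simp add: frontier_def) blast
qed

section \<open>Invariance\<close>

lemma invariant_pentagon: "invariant_set F pentagon"
  unfolding invariant_set_def
proof (intro allI impI)
  fix x y assume "(x, y) \<in> pentagon"
  then have b: "0 \<le> x" "x \<le> c" "0 \<le> y" "y \<le> c" "h * (y - xs) \<le> (2 * xs + 1) * x"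
    by (auto simp: pentagon_def)
  have p_eq: "p = xs + h" using xs_eq by simp
  \<comment> \<open>Nonnegativity of the numerator of \<open>F x y\<close>. To the right of
    \<open>xs\<close> the bound \<open>y \<le> c\<close> suffices; to the left the slanted edge
    bounds \<open>y\<close>.\<close>
  have "h * (1 + x + y) \<le> p + 2 * p * x"
  proof (cases "xs \<le> x")
    case True
    have "h * (1 + x + y) \<le> h * (1 + x + c)" using b h_pos by simp
    also have "\<dots> = h + h * x + xs * (2 * xs + h + 1)" using hc_eq by (simp add: algebra_simps)
    also have "\<dots> \<le> p + 2 * p * x"
      using mult_right_mono[OF True, of "2 * xs + h"] xs_pos h_pos
      by (simp add: p_eq algebra_simps)
    finally show ?thesis .
  next
    case False
    then have "(1 - h) * x \<le> (1 - h) * xs" using h_less by simp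
    then show ?thesis using b by (simp add: p_eq algebra_simps)
  qed
  then have nonneg: "0 \<le> F x y" using b by (simp add: F_eq field_simps)
  have "F x y \<le> F c 0" using b by (intro F_mono) auto
  also have "F c 0 \<le> c"
  proof -
    \<comment> \<open>The right side minus the left is
      \<open>c * (c - 2 * xs) + (c - h * c - xs)\<close>; both summands are nonnegative because
      \<open>h < 1 / 2\<close>.\<close>
    have "(p + 2 * p * c) \<le> (c + h) * (1 + c)"
    proof -
      have "0 < c" using xs_pos xs_less_c by simp
      have "h * (2 * xs) \<le> h * c"
        unfolding hc_eq using xs_pos h_less mult_right_mono[of "2 * h" "2 * xs + h + 1" xs] h_pos
        by (simp add: mult_ac)
      then have "2 * xs \<le> c" using h_pos by simp
      moreover have "h * c \<le> 1 / 2 * c" using h_less \<open>0 < c\<close> by (intro mult_right_mono) auto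
      ultimately have "xs \<le> c - h * c" "0 \<le> c * (c - 2 * xs)"
        using \<open>0 < c\<close> by (linarith, simp)
      then show ?thesis by (simp add: p_eq algebra_simps)
    qed
    then show ?thesis using b by (simp add: F_eq field_simps)
  qed
  finally have le_c: "F x y \<le> c" .
  have "h * (x - xs) \<le> (2 * xs + 1) * F x y"
  proof (cases "x \<le> xs")
    case True
    then have "h * (x - xs) \<le> 0" using h_pos by (simp add: mult_le_0_iff)
    also have "0 \<le> (2 * xs + 1) * F x y" using nonneg xs_pos by simp
    finally show ?thesis .
  next
    case False
    \<comment> \<open>By monotonicity \<open>y = c\<close> is the worst case, and the numerator
      factors because \<open>F xs c = 0\<close>.\<close>
    have "F x c = (2 * xs + h) * (x - xs) / (1 + x + c)"
    proof -
      have "p + 2 * p * x - h * (1 + x + c) = (2 * xs + h) * (x - xs)"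
        using hc_eq by (simp add: p_eq algebra_simps)
      moreover have "F x c = (p + 2 * p * x - h * (1 + x + c)) / (1 + x + c)"
        using b by (simp add: F_eq field_simps)
      ultimately show ?thesis by simp
    qed
    \<comment> \<open>Equality holds at \<open>x = c\<close>: the corner \<open>(c, c)\<close> is
      mapped to the vertex \<open>(xs, c)\<close>.\<close>
    moreover have "h * (1 + x + c) \<le> (2 * xs + 1) * (2 * xs + h)"
    proof -
      have "h * x \<le> h * c" using b h_pos by simp
      then show ?thesis using hc_eq by (simp add: algebra_simps)
    qed
    then have "h * (1 + x + c) * (x - xs) \<le> (2 * xs + 1) * (2 * xs + h) * (x - xs)"
      using False by (intro mult_right_mono) auto
    then have "h * (x - xs) \<le> (2 * xs + 1) * (2 * xs + h) * (x - xs) / (1 + x + c)"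
      using b by (simp add: le_divide_eq mult_ac)
    ultimately have "h * (x - xs) \<le> (2 * xs + 1) * F x c"
      by (simp add: mult.assoc)
    also have "F x c \<le> F x y" using b by (intro F_mono) auto
    then have "(2 * xs + 1) * F x c \<le> (2 * xs + 1) * F x y"
      using xs_pos by (intro mult_left_mono) auto
    finally show ?thesis .
  qed
  then show "(F x y, x) \<in> pentagon"
    using nonneg le_c b by (simp add: pentagon_def)
qed

section \<open>Attractivity\<close>

text \<open>Monotonicity alone only gives the lower bound \<open>F m M\<close>, which is too weak for attractivity.
  The gain comes from \<open>x = F y z\<close>: a value \<open>x\<close> below the equilibrium cannot be far below it
  when its predecessor \<open>y\<close> is large.\<close>

lemma F_lower:
  assumes "0 \<le> m" "m \<le> xs" and M: "xs \<le> M" and x: "m \<le> x" "x = F y z"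
    and y: "0 \<le> y" "y \<le> M" and z: "0 \<le> z" "z \<le> M"
  shows "min (F xs M) (F m xs) \<le> F x y"
proof -
  consider "xs \<le> x" | "y \<le> xs" | "x < xs" "xs < y" by linarith
  then show ?thesis
  proof cases
    case 1
    then have "F xs M \<le> F x y" using F_mono xs_pos y by simp
    then show ?thesis by simp
  next
    case 2
    then have "F m xs \<le> F x y" using F_mono assms by simp
    then show ?thesis by simp
  next
    case 3
    \<comment> \<open>In these deviations the goal \<open>F xs M \<le> F x y\<close> amounts to
      \<open>w * (q + 2 * s) \<le> (s - t) * q\<close>. The look-back \<open>F y M \<le> x\<close>
      supplies \<open>w * (q + s + t) \<le> p * (s - t)\<close>, and \<open>2 * p < q\<close>
      bridges the two.\<close>
    define q s t w where "q = 1 + 2 * xs" and "s = M - xs" and "t = y - xs" and "w = xs - x"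
    have "F y M \<le> x" using F_mono x y z by simp
    then have "w \<le> p * ((s - t) / (q + s + t))"
      using M y xs_pos by (simp add: F_deviation q_def s_def t_def w_def field_simps)
    moreover have pos: "0 < q + s + t" "0 < q + s" "0 < q + t - w" "0 < w" "0 \<le> s - t"
      using 3 assms xs_pos by (auto simp: q_def s_def t_def w_def)
    ultimately have w: "w * (q + s + t) \<le> p * (s - t)" by (simp add: field_simps)
    have "w * (q + 2 * s) * (q + s + t) \<le> p * (s - t) * (q + 2 * s)"
      using mult_right_mono[OF w, of "q + 2 * s"] 3 M xs_pos
      by (simp add: q_def s_def algebra_simps)
    also have "\<dots> \<le> (s - t) * q * (q + s + t)"
    proof -
      have "2 * p * (q + 2 * s) \<le> q * (q + 2 * s)"
        using p_less pos M by (intro mult_right_mono) (auto simp: q_def s_def)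
      also have "\<dots> \<le> 2 * (q * (q + s + t))"
        using 3 xs_pos by (simp add: q_def t_def algebra_simps)
      finally have "p * (q + 2 * s) \<le> q * (q + s + t)" by linarith
      then show ?thesis
        using mult_left_mono[of "p * (q + 2 * s)" "q * (q + s + t)" "s - t"] pos(5)
        by (simp only: mult_ac)
    qed
    finally have "w * (q + 2 * s) \<le> (s - t) * q" using pos by simp
    then have "(t + w) * (q + s) \<le> s * (q + t - w)" by (simp add: algebra_simps)
    then have "(t + w) / (q + t - w) \<le> s / (q + s)" using pos by (simp add: divide_simps)
    then have "p * ((t + w) / (q + t - w)) \<le> p * (s / (q + s))"
      using p_pos by (intro mult_left_mono) auto
    moreover have "F xs M = xs - p * (s / (q + s))"
      using M xs_pos by (simp add: F_deviation q_def s_def field_simps)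
    moreover have "F x y = xs - p * ((t + w) / (q + t - w))"
    proof -
      have "F x y = xs + p * (- ((t + w) / (q + t - w)))"
        using assms unfolding minus_divide_left
        by (subst F_deviation) (auto simp: q_def t_def w_def)
      then show ?thesis by simp
    qed
    ultimately have "F xs M \<le> F x y" by linarith
    then show ?thesis by simp
  qed
qed

text \<open>The \<open>min\<close> inequality makes the lower deviation \<open>i\<close> at most
  half of the upper deviation \<open>s\<close>. If \<open>s\<close> were positive,
  \<open>S \<le> F S I\<close> would then give \<open>q + s / 2 \<le> 3 / 2 * p\<close>, against
  \<open>2 * p < q\<close>.\<close>

lemma limit_bounds_collapse:
  assumes S: "xs \<le> S" "S \<le> F S I" and I: "0 \<le> I" "I \<le> xs" "min (F xs S) (F I xs) \<le> I"
  shows "S = xs \<and> I = xs"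
proof -
  define q s i where "q = 1 + 2 * xs" and "s = S - xs" and "i = xs - I"
  have nonneg: "0 \<le> s" "0 \<le> i" "0 < q" "2 * p < q" "0 < q + s - i"
    using assms xs_pos p_less by (auto simp: q_def s_def i_def)
  have "s \<le> p * ((s + i) / (q + s - i))"
    using S I xs_pos by (simp add: F_deviation q_def s_def i_def algebra_simps)
  then have upper: "s * (q + s - i) \<le> p * (s + i)"
    using nonneg by (simp add: field_simps)
  have lower: "i * (q + s) \<le> p * s"
  proof (cases "F xs S \<le> I")
    case True
    then have "i \<le> p * (s / (q + s))"
      using S I xs_pos by (simp add: F_deviation q_def s_def i_def field_simps)
    then show ?thesis using nonneg by (simp add: field_simps)
  next
    case False
    \<comment> \<open>Since \<open>p = xs + h\<close> and \<open>h < 1 / 2\<close>, we have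
      \<open>p < 1 + I + xs\<close>, so \<open>F I xs\<close> exceeds \<open>I\<close> unless
      \<open>I = xs\<close>.\<close>
    then have "F I xs \<le> I" using I by simp
    then have "i \<le> p * (i / (1 + I + xs))"
      using I xs_pos by (simp add: F_deviation i_def field_simps)
    then have "i * (1 + I + xs - p) \<le> 0" using I xs_pos by (simp add: field_simps)
    moreover have "0 < 1 + I + xs - p" using I h_less xs_eq by simp
    ultimately have "i = 0" using nonneg by (simp add: mult_le_0_iff)
    then show ?thesis using nonneg p_pos by simp
  qed
  have "s = 0"
  proof (rule ccontr)
    assume "s \<noteq> 0"
    then have s: "0 < s" using nonneg by simp
    have "2 * p * s \<le> (q + s) * s" using nonneg by (intro mult_right_mono) auto
    then have "2 * i * (q + s) \<le> s * (q + s)" using lower by (simp add: algebra_simps)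
    then have i: "2 * i \<le> s" using nonneg by simp
    have "p * (2 * i) \<le> p * s" using i p_pos by simp
    moreover have "s * (q + s / 2) \<le> s * (q + s - i)"
      using i s by simp
    moreover have "s * (3 / 2 * p) < s * (q + s / 2)" using s nonneg p_pos
      by (intro mult_strict_left_mono) auto
    ultimately show False using upper by (simp add: algebra_simps)
  qed
  moreover from this lower have "i = 0" using nonneg by (simp add: mult_le_0_iff)
  ultimately show ?thesis by (simp add: s_def i_def)
qed

lemma bounded_solution_tendsto:
  assumes sol: "is_solution F x" and bounds: "\<And>n. 0 \<le> x n" "\<And>n. x n \<le> c"
  shows "x \<longlonglongrightarrow> xs"
proof -
  \<comment> \<open>Eventual upper and lower bounds. Truncation at \<open>xs\<close> provides the
    \<open>m \<le> xs \<le> M\<close> that \<open>F_lower\<close> asks for, and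
    \<open>0 \<le> m\<close> keeps to the quadrant where \<open>F\<close> is monotone.\<close>
  define A where "A = {M. xs \<le> M \<and> (\<forall>\<^sub>F n in sequentially. x n \<le> M)}"
  define B where "B = {m. 0 \<le> m \<and> m \<le> xs \<and> (\<forall>\<^sub>F n in sequentially. m \<le> x n)}"
  define S I where "S = Inf A" and "I = Sup B"
  have step: "x (Suc (Suc n)) = F (x (Suc n)) (x n)" for n
    using sol by (simp add: is_solution_def)
  have c: "c \<in> A" and zero: "0 \<in> B"
    using bounds xs_less_c xs_pos by (auto simp: A_def B_def)
  have bdd: "bdd_below A" "bdd_above B"
    by (auto simp: A_def B_def intro: bdd_belowI bdd_aboveI)
  have S_ge: "xs \<le> S" unfolding S_def using c by (intro cInf_greatest) (auto simp: A_def)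
  have I_le: "I \<le> xs" unfolding I_def using zero by (intro cSup_least) (auto simp: B_def)
  have I_ge: "0 \<le> I" unfolding I_def using zero bdd by (intro cSup_upper)
  have A_up: "M \<in> A" if M: "S < M" for M
  proof -
    obtain M' where "M' \<in> A" "M' < M"
      using M c bdd cInf_less_iff[of A M] unfolding S_def by auto
    then show ?thesis by (auto simp: A_def elim: eventually_mono)
  qed
  have B_down: "m \<in> B" if m: "m < I" "0 \<le> m" for m
  proof -
    obtain m' where "m' \<in> B" "m < m'"
      using m zero bdd less_cSup_iff[of B m] unfolding I_def by auto
    then show ?thesis using m by (auto simp: B_def elim: eventually_mono)
  qed
  have improve: "S \<le> F M m" "min (F xs M) (F m xs) \<le> I" if "M \<in> A" "m \<in> B" for M m
  proof -
    have Mm: "0 \<le> m" "m \<le> xs" "xs \<le> M" using that by (auto simp: A_def B_def)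
    have "\<forall>\<^sub>F n in sequentially. m \<le> x n \<and> x n \<le> M"
      using that by (auto simp: A_def B_def intro: eventually_conj)
    then obtain N where N: "\<And>n. N \<le> n \<Longrightarrow> m \<le> x n \<and> x n \<le> M"
      unfolding eventually_sequentially by blast
    \<comment> \<open>The shift by three arises because \<open>F_lower\<close> expresses
      \<open>x (n + 2)\<close> through its two predecessors.\<close>
    have *: "x (n + 3) \<le> F M m \<and> min (F xs M) (F m xs) \<le> x (n + 3)" if "N \<le> n" for n
    proof -
      have "x (n + 3) = F (x (n + 2)) (x (n + 1))" "x (n + 2) = F (x (n + 1)) (x n)"
        using step[of n] step[of "n + 1"] by (simp_all add: eval_nat_numeral)
      then show ?thesis
        using F_mono[of "x (n + 2)" M m "x (n + 1)"]
          F_lower[of m M "x (n + 2)" "x (n + 1)" "x n"] Mm bounds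
          N[of n] N[of "n + 1"] N[of "n + 2"] that by simp
    qed
    have ev: "\<forall>\<^sub>F n in sequentially. x n \<le> F M m \<and> min (F xs M) (F m xs) \<le> x n"
      unfolding eventually_sequentially using *
      by (intro exI[of _ "N + 3"]) (metis add_leD2 add_le_imp_le_right le_add_diff_inverse2)
    have "F m m \<le> F M m" using F_mono Mm by simp
    then have "xs \<le> F M m" using Mm by (simp add: F_deviation)
    then have "F M m \<in> A" using ev by (auto simp: A_def elim: eventually_mono)
    then show "S \<le> F M m" unfolding S_def using bdd by (intro cInf_lower)
    have "F m xs \<le> F m m" using F_mono Mm by simp
    then have "F m xs \<le> xs" using Mm by (simp add: F_deviation)
    \<comment> \<open>The improved lower bound may be negative, whereas members of \<open>B\<close>
      are not.\<close>
    then have "max 0 (min (F xs M) (F m xs)) \<in> B"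
      using ev bounds xs_pos by (auto simp: B_def elim: eventually_mono)
    then have "max 0 (min (F xs M) (F m xs)) \<le> I"
      unfolding I_def using bdd by (intro cSup_upper)
    then show "min (F xs M) (F m xs) \<le> I" by simp
  qed
  \<comment> \<open>\<open>S\<close> and \<open>I\<close> themselves need not be eventual bounds, so
    they are approached from within \<open>A\<close> and \<open>B\<close>; continuity of
    \<open>F\<close> carries the inequalities to the limit.\<close>
  define M m where "M k = S + 1 / real (Suc k)" and "m k = max 0 (I - 1 / real (Suc k))" for k
  have "M k \<in> A" for k by (intro A_up) (simp add: M_def)
  moreover have "m k \<in> B" for k
    using B_down[of "m k"] zero by (cases "m k = 0") (auto simp: m_def max_def)
  ultimately have approx: "S \<le> F (M k) (m k)" "min (F xs (M k)) (F (m k) xs) \<le> I" for k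
    using improve by blast+
  have M_lim: "M \<longlonglongrightarrow> S"
    unfolding M_def using tendsto_add[OF tendsto_const lim_1_over_n[THEN LIMSEQ_Suc], of S] by simp
  have "m \<longlonglongrightarrow> max 0 (I - 0)"
    unfolding m_def by (intro tendsto_intros lim_1_over_n[THEN LIMSEQ_Suc])
  then have m_lim: "m \<longlonglongrightarrow> I" using I_ge by simp
  have "(\<lambda>k. F (M k) (m k)) \<longlonglongrightarrow> F S I"
    unfolding F_eq using S_ge I_ge xs_pos by (intro tendsto_intros M_lim m_lim) auto
  then have "S \<le> F S I" using approx by (intro LIMSEQ_le_const) auto
  moreover have "(\<lambda>k. min (F xs (M k)) (F (m k) xs)) \<longlonglongrightarrow> min (F xs S) (F I xs)"
    unfolding F_eq using S_ge I_ge xs_pos by (intro tendsto_intros M_lim m_lim) auto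
  then have "min (F xs S) (F I xs) \<le> I" using approx by (intro LIMSEQ_le_const2) auto
  ultimately have "Inf A = xs" "Sup B = xs"
    using limit_bounds_collapse[of S I] S_ge I_ge I_le by (auto simp: S_def I_def)
  show ?thesis
  proof (rule order_tendstoI)
    fix y assume "y < xs"
    then obtain m where "m \<in> B" "y < m"
      using zero bdd \<open>Sup B = xs\<close> less_cSup_iff[of B y] by auto
    then show "\<forall>\<^sub>F n in sequentially. y < x n" by (auto simp: B_def elim: eventually_mono)
  next
    fix y assume "xs < y"
    then obtain M where "M \<in> A" "M < y"
      using c bdd \<open>Inf A = xs\<close> cInf_less_iff[of A y] by auto
    then show "\<forall>\<^sub>F n in sequentially. x n < y" by (auto simp: A_def elim: eventually_mono)
  qed
qed

text \<open>Invariance keeps all consecutive pairs in the pentagon, which yields the bounds required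
  by \<open>bounded_solution_tendsto\<close>.\<close>

lemma globally_asymptotically_stable_pentagon: "globally_asymptotically_stable F xs pentagon"
  unfolding globally_asymptotically_stable_def
proof (intro conjI allI impI)
  fix x assume "is_solution F x \<and> (x 1, x 0) \<in> pentagon"
  then have sol: "is_solution F x" and start: "(x 1, x 0) \<in> pentagon" by auto
  have "(x (Suc n), x n) \<in> pentagon" for n
  proof (induction n)
    case 0
    then show ?case using start by simp
  next
    case (Suc n)
    then show ?case
      using sol invariant_pentagon by (simp add: is_solution_def invariant_set_def)
  qed
  then show "x \<longlonglongrightarrow> xs"
    by (intro bounded_solution_tendsto sol) (auto simp: pentagon_def)
qed (rule locally_stable_xs)

end

theorem corollary4p2:
  fixes p h xs c :: real
    and F :: "real \<Rightarrow> real \<Rightarrow> real"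
    and \<Omega> :: "(real \<times> real) set"
  assumes h_pos: "0 < h" and h_less: "h < min p (1 / 2)"
    and F_eq: "\<And>x y. F x y = (p + 2 * p * x) / (1 + x + y) - h"
    and xs_eq: "xs = p - h"
    and c_eq: "c = xs / h * (xs + p + 1)"
    and Omega_eq: "\<Omega> = polygon_region [(c, c), (xs, c), (0, xs), (0, 0), (c, 0)]"
  shows "{x. 0 < x \<and> equilibrium F x} = {xs} \<and>
         compact \<Omega> \<and> invariant_set F \<Omega> \<and>
         globally_asymptotically_stable F xs \<Omega>"
proof -
  interpret delay_map p h xs c F
    using assms by unfold_locales
  show ?thesis
    unfolding Omega_eq polygon_region_eq_pentagon
    using positive_equilibrium compact_pentagon invariant_pentagon
      globally_asymptotically_stable_pentagon by simp
qed

end
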